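(* Let $d$ be either $0$ or a positive square-free integer, $K=\mathbb{Q}(\sqrt{-d})$, $R$ the ring of integers of $K$. (a) $\chi(\Gamma_{1,n})=2$ for all $n\geq1$. (b) $\chi(\Gamma^{un}_{2,n})=2n+1$ for all $n\geq1$.
   Context: $\chi$ denotes the chromatic number. The zero-divisor graph $\Gamma(M_2(R))$ is the directed graph whose vertices are the nonzero (left or right) zero-divisors of $M_2(R)$, with an edge $v_1\to v_2$ between distinct vertices iff $v_1v_2=0$. For an integer $N\geq1$ and $t\in R$, let $S_{tc,1,t,N}=\{\lambda\begin{bmatrix}1&t\\t^2&t^3\end{bmatrix}:\lambda\in\mathbb{Z},\,1\leq|\lambda|\leq N\}$ and $S_{tc,2,N}=\{\begin{bmatrix}0&0\\0&\lambda\end{bmatrix}:\lambda\in\mathbb{Z},\,1\leq|\lambda|\leq N\}$. Let $\Gamma_{1,N}$ be the induced subgraph of $\Gamma(M_2(R))$ on $S_{tc,1,0,N}\cup S_{tc,2,N}$, regarded as an undirected graph. Let $U=\{\pm1\}$ if $d\neq1,3$, $U=\{\pm1,\pm i\}$ if $d=1$ ($i=\sqrt{-1}$), $U=\{\pm1,\pm\omega,\pm\omega^2\}$ if $d=3$ ($\omega$ a primitive third root of unity); let $\Gamma_{2,N}$ be the induced subgraph of $\Gamma(M_2(R))$ on $\bigcup_{j\in U}S_{tc,1,j,N}$, and $\Gamma^{un}_{2,N}$ its underlying undirected graph (distinct $v_1,v_2$ adjacent iff $v_1v_2=0$ or $v_2v_1=0$). *)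

theory Defs
  imports
    "HOL-Analysis.Analysis"
    "HOL-Computational_Algebra.Computational_Algebra"
    "HOL-Library.Extended_Nat"
    "Graph_Theory.Graph_Theory"
begin

definition is_subfield :: "'a::field set \<Rightarrow> bool" where
  "is_subfield F \<longleftrightarrow>
     0 \<in> F \<and> 1 \<in> F \<and>
     (\<forall>x\<in>F. \<forall>y\<in>F. x - y \<in> F \<and> x * y \<in> F) \<and>
     (\<forall>x\<in>F. x \<noteq> 0 \<longrightarrow> inverse x \<in> F)"

text \<open>
  The field \<open>\<rat>(\<surd>-d)\<close> inside the complex numbers. A subfield of the complex numbers
  automatically contains the rationals, so \<open>d = 0\<close> gives \<open>\<rat>\<close>.
\<close>

definition imag_quad_field :: "nat \<Rightarrow> complex set" where
  "imag_quad_field d = is_subfield hull {csqrt (- of_nat d)}"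

definition ring_of_integers :: "complex set \<Rightarrow> complex set" where
  "ring_of_integers K = {x \<in> K. algebraic_int x}"

definition mat2 :: "'a \<Rightarrow> 'a \<Rightarrow> 'a \<Rightarrow> 'a \<Rightarrow> 'a::zero ^ 2 ^ 2" where
  "mat2 a b c d = vector [vector [a, b], vector [c, d]]"

definition M2 :: "complex set \<Rightarrow> (complex ^ 2 ^ 2) set" where
  "M2 R = {A. \<forall>i j. A $ i $ j \<in> R}"

definition left_zero_divisor :: "complex set \<Rightarrow> complex ^ 2 ^ 2 \<Rightarrow> bool" where
  "left_zero_divisor R A \<longleftrightarrow> A \<in> M2 R \<and> (\<exists>B \<in> M2 R. B \<noteq> 0 \<and> A ** B = 0)"

definition right_zero_divisor :: "complex set \<Rightarrow> complex ^ 2 ^ 2 \<Rightarrow> bool" where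
  "right_zero_divisor R A \<longleftrightarrow> A \<in> M2 R \<and> (\<exists>B \<in> M2 R. B \<noteq> 0 \<and> B ** A = 0)"

definition zd_verts :: "complex set \<Rightarrow> (complex ^ 2 ^ 2) set" where
  "zd_verts R = {A. A \<noteq> 0 \<and> (left_zero_divisor R A \<or> right_zero_divisor R A)}"

definition zd_graph :: "complex set \<Rightarrow> (complex ^ 2 ^ 2) pair_pre_digraph" where
  "zd_graph R =
     \<lparr> pverts = zd_verts R,
       parcs = {(A, B). A \<in> zd_verts R \<and> B \<in> zd_verts R \<and> A \<noteq> B \<and> A ** B = 0} \<rparr>"

definition Stc1 :: "complex \<Rightarrow> nat \<Rightarrow> (complex ^ 2 ^ 2) set" where
  "Stc1 t N =
     {of_int l *\<^sub>R mat2 1 t (t ^ 2) (t ^ 3) | l :: int. 1 \<le> \<bar>l\<bar> \<and> \<bar>l\<bar> \<le> int N}"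

definition Stc2 :: "nat \<Rightarrow> (complex ^ 2 ^ 2) set" where
  "Stc2 N = {mat2 0 0 0 (of_int l) | l :: int. 1 \<le> \<bar>l\<bar> \<and> \<bar>l\<bar> \<le> int N}"

definition omega :: complex where
  "omega = cis (2 * pi / 3)"

definition U :: "nat \<Rightarrow> complex set" where
  "U d = (if d = 1 then {1, -1, \<i>, -\<i>}
          else if d = 3 then {1, -1, omega, -omega, omega ^ 2, - (omega ^ 2)}
          else {1, -1})"

text \<open>
  Undirected graphs are digraphs with a symmetric arc relation, and \<open>mk_symmetric\<close> passes to
  the underlying undirected graph.
\<close>

definition Gamma1 :: "complex set \<Rightarrow> nat \<Rightarrow> (complex ^ 2 ^ 2) pair_pre_digraph" where
  "Gamma1 R N = mk_symmetric (zd_graph R \<restriction> (Stc1 0 N \<union> Stc2 N))"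

definition Gamma2 ::
  "complex set \<Rightarrow> nat \<Rightarrow> nat \<Rightarrow> (complex ^ 2 ^ 2, (complex ^ 2 ^ 2) \<times> (complex ^ 2 ^ 2)) pre_digraph"
  where "Gamma2 R d N = zd_graph R \<restriction> (\<Union>j\<in>U d. Stc1 j N)"

definition Gamma2_un :: "complex set \<Rightarrow> nat \<Rightarrow> nat \<Rightarrow> (complex ^ 2 ^ 2) pair_pre_digraph" where
  "Gamma2_un R d N = mk_symmetric (Gamma2 R d N)"

definition proper_colouring :: "('a, 'b) pre_digraph \<Rightarrow> nat \<Rightarrow> ('a \<Rightarrow> nat) \<Rightarrow> bool" where
  "proper_colouring G k c \<longleftrightarrow>
     c ` verts G \<subseteq> {..<k} \<and> (\<forall>(u, v) \<in> arcs_ends G. c u \<noteq> c v)"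

text \<open>The value is \<open>\<infinity>\<close> if there is no proper colouring with finitely many colours.\<close>

definition chromatic_number :: "('a, 'b) pre_digraph \<Rightarrow> enat" where
  "chromatic_number G = Inf {enat k | k. \<exists>c. proper_colouring G k c}"

end

theory Submission
  imports Defs
begin

text \<open>
  The matrix with parameter \<open>t\<close> is the column \<open>(1, t\<^sup>2)\<close> times the row \<open>(1, t)\<close>, so the
  product of those with parameters \<open>s\<close> and \<open>t\<close> vanishes iff \<open>s t\<^sup>2 = -1\<close>. Every \<open>u \<in> U d\<close>
  satisfies \<open>u\<^sup>3 = \<plusminus>1\<close> or \<open>u\<^sup>6 = -1\<close>, so an arc from \<open>s\<close> to \<open>t\<close> forces either
  \<open>s\<^sup>3 = -1\<close> and \<open>t\<^sup>3 = \<plusminus>1\<close>, or \<open>s\<^sup>3 = 1\<close> and \<open>t\<^sup>6 = -1\<close>. Hence colouring the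
  multiples with \<open>t\<^sup>3 = -1\<close> by their scalar (\<open>2n\<close> colours), those with \<open>t\<^sup>3 = 1\<close> by one new
  colour, and the remaining ones by an old colour is proper. Conversely the \<open>2n\<close> multiples
  for \<open>t = -1\<close> together with the matrix for \<open>t = 1\<close> form a clique.
\<close>

text \<open>A proper colouring is injective on a clique, so \<open>card C\<close> bounds the number
  of colours from below, and the given colouring attains this bound.\<close>

lemma chromatic_number_eqI:
  assumes col: "proper_colouring G k c"
    and C: "finite C" "C \<subseteq> verts G" "card C = k"
    and clique: "\<And>u v. u \<in> C \<Longrightarrow> v \<in> C \<Longrightarrow> u \<noteq> v \<Longrightarrow> (u, v) \<in> arcs_ends G"
  shows "chromatic_number G = enat k"
proof -
  have "k \<le> m" if p: "proper_colouring G m f" for m f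
  proof -
    have "inj_on f C"
      using p clique unfolding proper_colouring_def inj_on_def by blast
    moreover have "f ` C \<subseteq> {..<m}"
      using p C unfolding proper_colouring_def by blast
    ultimately have "card C \<le> card {..<m}"
      by (intro card_inj_on_le) auto
    then show ?thesis using C by simp
  qed
  then show ?thesis
    using col unfolding chromatic_number_def
    by (intro antisym Inf_lower Inf_greatest) auto
qed

section \<open>Arithmetic of two-by-two matrices\<close>

lemma mat2_nth [simp]:
  "mat2 a b c d $ 1 $ 1 = a" "mat2 a b c d $ 1 $ 2 = b"
  "mat2 a b c d $ 2 $ 1 = c" "mat2 a b c d $ 2 $ 2 = d"
  by (simp_all add: mat2_def)

lemma mat2_mult:
  fixes a :: "'a::comm_semiring_1"
  shows "mat2 a b c d ** mat2 a' b' c' d' =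
    mat2 (a * a' + b * c') (a * b' + b * d') (c * a' + d * c') (c * b' + d * d')"
  by (simp add: vec_eq_iff forall_2 matrix_matrix_mult_def sum_2)

lemma mat2_eq_iff:
  "mat2 a b c d = mat2 a' b' c' d' \<longleftrightarrow> a = a' \<and> b = b' \<and> c = c' \<and> d = d'"
  by (auto simp add: vec_eq_iff forall_2)

lemma mat2_zero: "0 = mat2 0 0 0 0"
  by (simp add: vec_eq_iff forall_2)

lemma scaleR_mat2:
  fixes a :: complex
  shows "r *\<^sub>R mat2 a b c d = mat2 (r *\<^sub>R a) (r *\<^sub>R b) (r *\<^sub>R c) (r *\<^sub>R d)"
  by (simp add: vec_eq_iff forall_2)

lemma mat2_in_M2 [simp]:
  "mat2 a b c d \<in> M2 R \<longleftrightarrow> a \<in> R \<and> b \<in> R \<and> c \<in> R \<and> d \<in> R"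
  by (auto simp add: M2_def forall_2)

lemma of_int_in_subfield:
  assumes "is_subfield F"
  shows "of_int l \<in> F"
proof -
  have F: "0 \<in> F" "1 \<in> F"
    using assms by (auto simp: is_subfield_def)
  have diff: "x - y \<in> F" if "x \<in> F" "y \<in> F" for x y
    using assms that by (auto simp: is_subfield_def)
  \<comment> \<open>Only differences are available, so \<open>x + 1\<close> is obtained as
    \<open>x - (0 - 1)\<close>.\<close>
  have pred: "x - 1 \<in> F" and succ: "x + 1 \<in> F" if "x \<in> F" for x
    using diff[of x 1] diff[of x "0 - 1"] diff[of 0 1] F that by auto
  show ?thesis
    by (induction l rule: int_induct[where k = 0]) (use F pred succ in auto)
qed

lemma of_int_in_ring_of_integers:
  "of_int l \<in> ring_of_integers (imag_quad_field d)"
  by (auto simp: ring_of_integers_def imag_quad_field_def hull_def of_int_in_subfield)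

text \<open>If \<open>A ** B = 0\<close> with both factors nonzero, each factor witnesses that the
  other is a zero-divisor, so the vertex condition reduces to being a nonzero element of
  \<open>M2 R\<close>.\<close>

lemma mk_symmetric_zd_graph_arc_iff:
  "(A, B) \<in> parcs (mk_symmetric (zd_graph R \<restriction> S)) \<longleftrightarrow>
     A \<in> S \<and> B \<in> S \<and> A \<noteq> B \<and> A \<in> M2 R \<and> B \<in> M2 R \<and> A \<noteq> 0 \<and> B \<noteq> 0 \<and>
     (A ** B = 0 \<or> B ** A = 0)"
  by (auto simp: parcs_mk_symmetric zd_graph_def zd_verts_def
      left_zero_divisor_def right_zero_divisor_def)

abbreviation tc_mat :: "int \<Rightarrow> complex \<Rightarrow> complex ^ 2 ^ 2" where
  "tc_mat l t \<equiv> mat2 (of_int l) (of_int l * t) (of_int l * t\<^sup>2) (of_int l * t ^ 3)"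

lemma Stc1_altdef:
  "Stc1 t N = (\<lambda>l. tc_mat l t) ` {l. 1 \<le> \<bar>l\<bar> \<and> \<bar>l\<bar> \<le> int N}"
  unfolding Stc1_def scaleR_mat2 by (auto simp: scaleR_conv_of_real)

text \<open>Third roots of unity and their negatives have cubes 1 and -1; cubing swaps
  \<open>\<i>\<close> and \<open>-\<i>\<close>, whose squares are -1.\<close>

lemma U_cube_cases:
  assumes "u \<in> U d"
  obtains "u ^ 3 = 1" | "u ^ 3 = -1" | "(u ^ 3)\<^sup>2 = -1"
proof -
  have "omega ^ 3 = 1"
    by (simp add: omega_def Complex.DeMoivre)
  moreover from this have "(omega\<^sup>2) ^ 3 = 1"
    by (metis power_mult mult.commute power_one)
  ultimately show ?thesis
    using assms that by (auto simp: U_def split: if_splits)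
qed

section \<open>The first graph\<close>

lemma chromatic_number_Gamma1:
  assumes R: "\<And>l. of_int l \<in> R" and "n \<ge> 1"
  shows "chromatic_number (Gamma1 R n) = enat 2"
proof -
  let ?A = "mat2 1 0 0 0 :: complex^2^2" and ?B = "mat2 0 0 0 1 :: complex^2^2"
  \<comment> \<open>The upper left entry vanishes exactly on \<open>Stc2 n\<close>; two elements of
    the same set have a nonzero product.\<close>
  let ?c = "\<lambda>A :: complex^2^2. if A $ 1 $ 1 = 0 then 0 else 1 :: nat"
  have "0 \<in> R" "1 \<in> R"
    using R[of 0] R[of 1] by simp_all
  show ?thesis
  proof (rule chromatic_number_eqI)
    show "proper_colouring (Gamma1 R n) 2 ?c"
      unfolding proper_colouring_def Gamma1_def
      by (auto simp: mk_symmetric_zd_graph_arc_iff Stc1_altdef Stc2_def mat2_mult mat2_zero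
          mat2_eq_iff)
    have "?A \<in> Stc1 0 n" "?B \<in> Stc2 n"
      using \<open>n \<ge> 1\<close> by (auto simp: Stc1_altdef Stc2_def mat2_eq_iff intro!: image_eqI[of _ _ 1] exI[of _ 1])
    then show "{?A, ?B} \<subseteq> verts (Gamma1 R n)"
      by (simp add: Gamma1_def)
    show "(u, v) \<in> arcs_ends (Gamma1 R n)" if "u \<in> {?A, ?B}" "v \<in> {?A, ?B}" "u \<noteq> v" for u v
      using that \<open>?A \<in> _\<close> \<open>?B \<in> _\<close> \<open>0 \<in> R\<close> \<open>1 \<in> R\<close>
      by (auto simp: Gamma1_def mk_symmetric_zd_graph_arc_iff mat2_mult mat2_zero mat2_eq_iff)
  qed (auto simp: mat2_eq_iff)
qed

section \<open>The second graph\<close>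

definition signed_index :: "nat \<Rightarrow> int \<Rightarrow> nat" where
  "signed_index n l = (if l > 0 then nat l - 1 else nat (- l) - 1 + n)"

lemma signed_index_less: "1 \<le> \<bar>l\<bar> \<Longrightarrow> \<bar>l\<bar> \<le> int n \<Longrightarrow> signed_index n l < 2 * n"
  by (auto simp: signed_index_def)

text \<open>Positive scalars occupy \<open>{..<n}\<close>, and the shift by \<open>n\<close> moves
  the negative ones to \<open>{n..<2 * n}\<close>.\<close>

lemma signed_index_inject:
  assumes "1 \<le> \<bar>l\<bar>" "\<bar>l\<bar> \<le> int n" "1 \<le> \<bar>m\<bar>" "\<bar>m\<bar> \<le> int n"
  shows "signed_index n l = signed_index n m \<longleftrightarrow> l = m"
  using assms by (auto simp: signed_index_def split: if_splits)

text \<open>Scalar and parameter are recovered from the first row \<open>(l, l * t)\<close>;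
  \<open>\<lfloor>Re l\<rfloor>\<close> turns the complex entry back into an integer.\<close>

definition Gamma2_colour :: "nat \<Rightarrow> complex ^ 2 ^ 2 \<Rightarrow> nat" where
  "Gamma2_colour n A =
     (let l = A $ 1 $ 1; t = A $ 1 $ 2 / l
      in if t ^ 3 = -1 then signed_index n \<lfloor>Re l\<rfloor> else if t ^ 3 = 1 then 2 * n else 0)"

lemma tc_mat_mult_eq_0_iff:
  assumes "l \<noteq> 0" "m \<noteq> 0"
  shows "tc_mat l s ** tc_mat m t = 0 \<longleftrightarrow> s * t\<^sup>2 = -1"
proof
  assume "tc_mat l s ** tc_mat m t = 0"
  then have "of_int l * of_int m * (1 + s * t\<^sup>2) = 0"
    by (simp add: mat2_mult mat2_zero mat2_eq_iff algebra_simps)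
  with assms show "s * t\<^sup>2 = -1"
    by (simp add: add_eq_0_iff)
next
  assume st: "s * t\<^sup>2 = -1"
  have "tc_mat l s ** tc_mat m t =
    (let k = of_int l * of_int m * (1 + s * t\<^sup>2) in mat2 k (k * t) (k * s\<^sup>2) (k * s\<^sup>2 * t))"
    by (simp add: mat2_mult mat2_eq_iff algebra_simps power2_eq_square power3_eq_cube)
  with st show "tc_mat l s ** tc_mat m t = 0"
    by (simp add: mat2_zero)
qed

lemma Gamma2_colour_tc_mat:
  assumes "l \<noteq> 0"
  shows "Gamma2_colour n (tc_mat l t) =
    (if t ^ 3 = -1 then signed_index n l else if t ^ 3 = 1 then 2 * n else 0)"
  using assms by (simp add: Gamma2_colour_def)

lemma Gamma2_colour_neq:
  assumes "t \<in> U d"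
    and l: "1 \<le> \<bar>l\<bar>" "\<bar>l\<bar> \<le> int n" and m: "1 \<le> \<bar>m\<bar>" "\<bar>m\<bar> \<le> int n"
    and neq: "tc_mat l s \<noteq> tc_mat m t" and zero: "tc_mat l s ** tc_mat m t = 0"
  shows "Gamma2_colour n (tc_mat l s) \<noteq> Gamma2_colour n (tc_mat m t)"
proof -
  have nz: "l \<noteq> 0" "m \<noteq> 0" and "n > 0"
    using l m by auto
  have eq: "s * t\<^sup>2 = -1"
    using zero nz by (simp add: tc_mat_mult_eq_0_iff)
  then have "(s * t\<^sup>2) ^ 3 = -1"
    by simp
  then have cube: "s ^ 3 * (t ^ 3)\<^sup>2 = -1"
    by (simp add: power_mult_distrib flip: power_mult)
  note colour = Gamma2_colour_tc_mat[OF nz(1)] Gamma2_colour_tc_mat[OF nz(2)]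
  note bounds = signed_index_less[OF l] signed_index_less[OF m]
  show ?thesis
    using \<open>t \<in> U d\<close>
  proof (cases rule: U_cube_cases)
    \<comment> \<open>Here \<open>s ^ 3 = -1\<close>, so the colour of the left factor is below
      \<open>2 * n\<close>, the colour of the right one.\<close>
    case 1
    with cube bounds show ?thesis
      unfolding colour by simp
  next
    case 2
    with cube have s: "s ^ 3 = -1"
      by simp
    \<comment> \<open>Multiplying \<open>s * t\<^sup>2 = -1\<close> by \<open>t\<close> forces equal
      parameters, so distinct matrices have distinct scalars.\<close>
    have "s * t ^ 3 = - t"
      using eq by (simp add: power2_eq_square power3_eq_cube flip: mult.assoc)
    with 2 have "s = t"
      by simp
    with neq have "l \<noteq> m"
      by auto
    with s 2 l m show ?thesis
      unfolding colour by (simp add: signed_index_inject)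
  next
    case 3
    with cube have "s ^ 3 = 1"
      by simp
    moreover have "t ^ 3 \<noteq> 1" "t ^ 3 \<noteq> -1"
      using 3 by (metis power2_minus one_power2 one_neq_neg_one)+
    \<comment> \<open>The colours are \<open>2 * n\<close> and the default 0, which differ because
      \<open>n > 0\<close>.\<close>
    ultimately show ?thesis
      using \<open>n > 0\<close> unfolding colour by simp
  qed
qed

lemma proper_colouring_Gamma2_un:
  "proper_colouring (Gamma2_un R d n) (2 * n + 1) (Gamma2_colour n)"
proof -
  have "Gamma2_colour n A < 2 * n + 1" if "A \<in> Stc1 t n" for A t
    using that signed_index_less[of _ n]
    by (fastforce simp: Stc1_altdef Gamma2_colour_tc_mat)
  moreover have "Gamma2_colour n A \<noteq> Gamma2_colour n B"
    if "t \<in> U d" "A \<in> Stc1 s n" "B \<in> Stc1 t n" "A \<noteq> B" "A ** B = 0" for A B s t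
    using that Gamma2_colour_neq[of t d] by (auto simp: Stc1_altdef)
  ultimately show ?thesis
    unfolding proper_colouring_def Gamma2_un_def Gamma2_def
    by (fastforce simp: mk_symmetric_zd_graph_arc_iff)
qed

lemma chromatic_number_Gamma2_un:
  assumes R: "\<And>l. of_int l \<in> R" and "n \<ge> 1"
  shows "chromatic_number (Gamma2_un R d n) = enat (2 * n + 1)"
proof (rule chromatic_number_eqI[OF proper_colouring_Gamma2_un])
  define I where "I = {l. 1 \<le> \<bar>l\<bar> \<and> \<bar>l\<bar> \<le> int n}"
  have I: "I = {- int n..-1} \<union> {1..int n}"
    by (auto simp: I_def)
  then have "finite I" and card_I: "card I = 2 * n"
    by (auto simp: card_Un_disjoint)
  let ?C = "insert (tc_mat 1 1) ((\<lambda>l. tc_mat l (-1)) ` I)"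
  show "finite ?C"
    using \<open>finite I\<close> by simp
  have "inj_on (\<lambda>l. tc_mat l (-1)) I"
    by (auto simp: inj_on_def mat2_eq_iff)
  then show "card ?C = 2 * n + 1"
    using \<open>finite I\<close> card_I by (subst card_insert_disjoint) (auto simp: card_image mat2_eq_iff)
  have "tc_mat 1 1 \<in> Stc1 1 n"
    unfolding Stc1_altdef using \<open>n \<ge> 1\<close> by (intro image_eqI[of _ _ 1]) auto
  moreover have "(\<lambda>l. tc_mat l (-1)) ` I = Stc1 (-1) n"
    by (simp add: Stc1_altdef I_def)
  moreover have "1 \<in> U d" "-1 \<in> U d"
    by (auto simp: U_def)
  ultimately have sub: "?C \<subseteq> (\<Union>j\<in>U d. Stc1 j n)"
    by blast
  then show "?C \<subseteq> verts (Gamma2_un R d n)"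
    by (simp add: Gamma2_un_def Gamma2_def)
  show "(u, v) \<in> arcs_ends (Gamma2_un R d n)" if uv: "u \<in> ?C" "v \<in> ?C" "u \<noteq> v" for u v
  proof -
    have R': "of_int l \<in> R" "- of_int l \<in> R" for l
      using R[of l] R[of "- l"] by simp_all
    have "A \<in> M2 R \<and> A \<noteq> 0" if "A \<in> ?C" for A
      using that R' R'[of 1] by (auto simp: I_def mat2_zero mat2_eq_iff)
    moreover have "u ** v = 0 \<or> v ** u = 0"
    proof -
      \<comment> \<open>For \<open>s = -1\<close> the condition \<open>s * t\<^sup>2 = -1\<close>
        holds at both \<open>t = 1\<close> and \<open>t = -1\<close>, which covers all pairs in the
        clique.\<close>
      have "tc_mat l (-1) ** tc_mat m t = 0" if "l \<in> I" "m \<noteq> 0" "t\<^sup>2 = 1" for l m t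
        using that by (subst tc_mat_mult_eq_0_iff) (auto simp: I_def)
      from this[of _ 1 1] this[of _ _ "-1"]
      have "tc_mat l (-1) ** tc_mat 1 1 = 0" "tc_mat l (-1) ** tc_mat m (-1) = 0"
        if "l \<in> I" "m \<in> I" for l m
        using that by (force simp: I_def)+
      with uv show ?thesis
        by blast
    qed
    ultimately show ?thesis
      using uv sub 
      unfolding Gamma2_un_def Gamma2_def with_proj_simps mk_symmetric_zd_graph_arc_iff by blast
  qed
qed

theorem theorem3p18:
  fixes d :: nat and K R :: "complex set"
  assumes "d = 0 \<or> (d > 0 \<and> squarefree d)"
    and "K = imag_quad_field d"
    and "R = ring_of_integers K"
  shows "(\<forall>n\<ge>1. chromatic_number (Gamma1 R n) = 2) \<and>
         (\<forall>n\<ge>1. chromatic_number (Gamma2_un R d n) = enat (2 * n + 1))"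
  using assms(2,3)
  by (simp add: chromatic_number_Gamma1 chromatic_number_Gamma2_un of_int_in_ring_of_integers
      numeral_eq_enat)

end
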